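(* For each $n\ge 1$ let $G_n$ be a random simple graph on the vertex set $[n]$, sampled according to some probability distribution over the set of all simple graphs on $[n]$, and let $c=c(n)$ be positive integers with $c(n)\to\infty$. Let $N(G_n)$ be the number of monochromatic edges when the vertices of $G_n$ are colored independently and uniformly at random with $c$ colors (independently of $G_n$). Then, as $n\to\infty$: (1) if $\frac{1}{c}|E(G_n)|\to 0$ in probability, then $N(G_n)\to 0$ in distribution; (2) if $\frac{1}{c}|E(G_n)|\to \infty$ in probability, then $N(G_n)\to\infty$ (that is, $\mathbb{P}(N(G_n)>K)\to 1$ for every $K<\infty$); (3) if $\frac{1}{c}|E(G_n)|\to Z$ in distribution for some random variable $Z$, then $N(G_n)\to W$ in distribution, where $\mathbb{P}(W=k)=\frac{1}{k!}\mathbb{E}(e^{-Z}Z^k)$ for all integers $k\ge 0$ (i.e. $W$ is a mixture of Poisson random variables, mixed over $Z$).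
   Context: $[n]=\{1,\dots,n\}$; $E(G_n)$ is the edge set of $G_n$. The colors $Y_1,\dots,Y_n$ of the vertices are i.i.d. uniform on $\{1,\dots,c\}$ and independent of $G_n$, and $N(G_n)=\sum_{(i,j)\in E(G_n)}\mathbf{1}\{Y_i=Y_j\}$. Deterministic graph sequences are included as a special case. *)

theory Defs
  imports "HOL-Probability.Probability"
begin

text \<open>
  A simple graph on the fixed vertex set \<open>{1..n}\<close> is given by its edge set; the
  unordered edge \<open>{i, j}\<close> is represented by the ordered pair \<open>(i, j)\<close> with \<open>i < j\<close>,
  so that every edge is counted exactly once.
\<close>

definition simple_graphs :: "nat \<Rightarrow> (nat \<times> nat) set set" where
  "simple_graphs n = Pow {(i, j). 1 \<le> i \<and> i < j \<and> j \<le> n}"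

definition mono_edges :: "(nat \<times> nat) set \<Rightarrow> (nat \<Rightarrow> nat) \<Rightarrow> nat" where
  "mono_edges E y = (\<Sum>(i, j)\<in>E. of_bool (y i = y j))"

text \<open>Outside \<open>{1..n}\<close> a colouring takes the dummy value \<open>0\<close>.\<close>

definition uniform_colouring :: "nat \<Rightarrow> nat \<Rightarrow> (nat \<Rightarrow> nat) pmf" where
  "uniform_colouring n c = Pi_pmf {1..n} 0 (\<lambda>_. pmf_of_set {1..c})"

text \<open>
  The joint law of the random graph, with law \<open>p\<close> on the simple graphs on \<open>{1..n}\<close>, and of
  an independent uniform colouring of its vertices.
\<close>

definition coloured_graph :: "nat \<Rightarrow> nat \<Rightarrow> (nat \<times> nat) set pmf \<Rightarrow>
    ((nat \<times> nat) set \<times> (nat \<Rightarrow> nat)) pmf" where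
  "coloured_graph n c p = pair_pmf p (uniform_colouring n c)"

text \<open>
  In the following, \<open>X n\<close> is a real random variable on the probability space \<open>M n\<close>;
  the spaces may vary with \<open>n\<close>, so limits in probability are deterministic, and a
  limit in distribution is given by its law.
\<close>

definition tendsto_in_prob :: "(nat \<Rightarrow> 'a measure) \<Rightarrow> (nat \<Rightarrow> 'a \<Rightarrow> real) \<Rightarrow> real \<Rightarrow> bool" where
  "tendsto_in_prob M X a \<longleftrightarrow>
     (\<forall>\<epsilon>>0. (\<lambda>n. measure (M n) {\<omega> \<in> space (M n). \<bar>X n \<omega> - a\<bar> > \<epsilon>}) \<longlonglongrightarrow> 0)"

definition tendsto_infinity_in_prob :: "(nat \<Rightarrow> 'a measure) \<Rightarrow> (nat \<Rightarrow> 'a \<Rightarrow> real) \<Rightarrow> bool" where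
  "tendsto_infinity_in_prob M X \<longleftrightarrow>
     (\<forall>K. (\<lambda>n. measure (M n) {\<omega> \<in> space (M n). X n \<omega> > K}) \<longlonglongrightarrow> 1)"

definition tendsto_in_distr ::
    "(nat \<Rightarrow> 'a measure) \<Rightarrow> (nat \<Rightarrow> 'a \<Rightarrow> real) \<Rightarrow> real measure \<Rightarrow> bool" where
  "tendsto_in_distr M X \<mu> \<longleftrightarrow> weak_conv_m (\<lambda>n. distr (M n) borel (X n)) \<mu>"

end

theory Submission
  imports Defs
begin

text \<open>
  Fix a graph with \<open>m\<close> edges and write \<open>N\<close> for its number of monochromatic edges. Colour the vertices one
  after the other. A vertex with \<open>d\<close> earlier neighbours creates on average exactly \<open>d / c\<close> new monochromatic
  edges, whatever the earlier colours are, and it creates more than one with probability at most of order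
  \<open>d\<^sup>2 / c\<^sup>2\<close>. So \<open>N\<close> behaves like a sum of independent rare events of total intensity \<open>m / c\<close>, with an
  error governed by the sum of the \<open>d\<^sup>2 / c\<^sup>2\<close>. Every graph with \<open>m\<close> edges has a vertex of degree at most
  \<open>sqrt (2 * m)\<close> (\<open>ex_low_degree_vertex\<close>), so in a suitable order this sum is at most
  \<open>m * sqrt (2 * m) / c\<^sup>2\<close>. This gives \<open>poisson_approximation\<close>: for \<open>\<bar>w\<bar> = 1\<close> the expectation of \<open>w ^ N\<close>
  differs from \<open>exp ((w - 1) * m / c)\<close>, the value for a Poisson variable, by at most
  \<open>6 * m * sqrt (2 * m) / c\<^sup>2\<close>, which is small as soon as \<open>m / c\<close> is bounded and \<open>c\<close> is large.

  For a random graph, average this bound over the law of the graph. If \<open>m / c\<close> converges in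
  distribution to \<open>Z\<close>, then the characteristic function of \<open>N\<close> at \<open>t\<close> converges to the expectation of
  \<open>exp ((iexp t - 1) * Z)\<close> (\<open>char_mono_edges_tendsto_mixed_poisson\<close>), which is the characteristic function of
  the Poisson law mixed over \<open>Z\<close> (\<open>ex_mixed_poisson_pmf\<close>), and Levy's continuity theorem yields the third
  claim. The first claim is the case where the limit is a point mass at 0. In the second claim \<open>m / c\<close> is
  large and the Poisson bound is useless, but \<open>N\<close> has mean \<open>m / c\<close> and variance at most \<open>m / c\<close>, so Chebyshev's
  inequality suffices (\<open>prob_many_mono_edges_ge\<close>).
\<close>

section \<open>Uniform colourings of a finite vertex set\<close>

text \<open>
  The vertex set is an arbitrary finite set, not only an initial segment, because the main estimates
  remove vertices one at a time.
\<close>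
definition random_colouring :: "nat set \<Rightarrow> nat \<Rightarrow> (nat \<Rightarrow> nat) pmf" where
  "random_colouring A c = Pi_pmf A 0 (\<lambda>_. pmf_of_set {1..c})"

lemma expectation_pair_pmf_finite:
  fixes f :: "'a \<times> 'b \<Rightarrow> 'c :: {banach, second_countable_topology}"
  assumes "finite (set_pmf p)" "finite (set_pmf q)"
  shows "measure_pmf.expectation (pair_pmf p q) f =
           measure_pmf.expectation p (\<lambda>a. measure_pmf.expectation q (\<lambda>b. f (a, b)))"
proof -
  have "pair_pmf p q = p \<bind> (\<lambda>a. map_pmf (Pair a) q)"
    by (simp add: pair_pmf_def map_pmf_def)
  then have "measure_pmf.expectation (pair_pmf p q) f =
      (\<Sum>a\<in>set_pmf p. pmf p a *\<^sub>R measure_pmf.expectation (map_pmf (Pair a) q) f)"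
    using assms by (simp add: pmf_expectation_bind[of "set_pmf p"])
  also have "\<dots> = measure_pmf.expectation p (\<lambda>a. measure_pmf.expectation q (\<lambda>b. f (a, b)))"
    using assms(1) by (subst integral_measure_pmf[of "set_pmf p"]) auto
  finally show ?thesis .
qed

lemma finite_random_colouring:
  "finite A \<Longrightarrow> c > 0 \<Longrightarrow> finite (set_pmf (random_colouring A c))"
  unfolding random_colouring_def by (auto simp: set_Pi_pmf intro!: finite_PiE_dflt)

lemma random_colouring_in_colours:
  assumes "finite A" "c > 0" "y \<in> set_pmf (random_colouring A c)" "u \<in> A"
  shows "y u \<in> {1..c}"
  using assms set_Pi_pmf[of A 0 "\<lambda>_. pmf_of_set {1..c}"]
  by (fastforce simp: random_colouring_def PiE_dflt_def)

text \<open>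
  Colouring the vertices one after the other: the colour of a new vertex is averaged out with the
  colours of all the others held fixed.
\<close>
lemma expectation_random_colouring_insert:
  fixes f :: "(nat \<Rightarrow> nat) \<Rightarrow> 'b :: {banach, second_countable_topology}"
  assumes "finite A" "v \<notin> A" "c > 0"
  shows "measure_pmf.expectation (random_colouring (insert v A) c) f =
    measure_pmf.expectation (random_colouring A c) (\<lambda>y. (\<Sum>x=1..c. f (y(v := x))) /\<^sub>R real c)"
proof -
  have "random_colouring (insert v A) c =
      map_pmf (\<lambda>(y, x). y(v := x)) (pair_pmf (random_colouring A c) (pmf_of_set {1..c}))"
    unfolding random_colouring_def Pi_pmf_insert[OF assms(1,2)]
    by (subst pair_commute_pmf) (simp add: pmf.map_comp o_def case_prod_beta')
  moreover have "measure_pmf.expectation (pmf_of_set {1..c}) (\<lambda>x. f (y(v := x))) =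
      (\<Sum>x=1..c. f (y(v := x))) /\<^sub>R real c" for y
    using assms(3) by (subst integral_measure_pmf[of "{1..c}"])
      (auto simp: scaleR_sum_right inverse_eq_divide)
  ultimately show ?thesis
    using assms finite_random_colouring[of A c]
    by (simp add: expectation_pair_pmf_finite)
qed

lemma expectation_same_colour:
  assumes A: "finite A" "u \<in> A" "w \<in> A" "u \<noteq> w" and c: "c > 0"
  shows "measure_pmf.expectation (random_colouring A c) (\<lambda>y. of_bool (y u = y w) :: real) = 1 / c"
proof -
  let ?B = "A - {u}"
  have "measure_pmf.expectation (random_colouring A c) (\<lambda>y. of_bool (y u = y w) :: real) =
        measure_pmf.expectation (random_colouring ?B c) (\<lambda>y. (\<Sum>x=1..c. of_bool (x = y w)) /\<^sub>R real c)"
    using expectation_random_colouring_insert[of ?B u c "\<lambda>y. of_bool (y u = y w) :: real"] A c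
    by (simp add: insert_absorb)
  also have "\<dots> = measure_pmf.expectation (random_colouring ?B c) (\<lambda>y. 1 / c)"
  proof (intro integral_cong_AE AE_pmfI)
    fix y assume "y \<in> set_pmf (random_colouring ?B c)"
    then have "y w \<in> {1..c}"
      using random_colouring_in_colours[of ?B c y w] A c by auto
    then show "(\<Sum>x=1..c. of_bool (x = y w) :: real) /\<^sub>R real c = 1 / c"
      by (simp add: of_bool_def divide_inverse)
  qed auto
  finally show ?thesis by simp
qed

section \<open>Removing a vertex from a graph\<close>

definition edges_on :: "nat set \<Rightarrow> (nat \<times> nat) set" where
  "edges_on A = {(i, j). i \<in> A \<and> j \<in> A \<and> i < j}"

definition nbrs :: "(nat \<times> nat) set \<Rightarrow> nat \<Rightarrow> nat set" where
  "nbrs E v = {u. (u, v) \<in> E \<or> (v, u) \<in> E}"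

definition del_vertex :: "nat \<Rightarrow> (nat \<times> nat) set \<Rightarrow> (nat \<times> nat) set" where
  "del_vertex v E = {(i, j) \<in> E. i \<noteq> v \<and> j \<noteq> v}"

lemma finite_edges_on: "finite A \<Longrightarrow> finite (edges_on A)"
  by (rule finite_subset[of _ "A \<times> A"]) (auto simp: edges_on_def)

lemma sum_split_vertex:
  fixes f :: "nat \<times> nat \<Rightarrow> 'b :: comm_monoid_add"
  assumes "finite A" "E \<subseteq> edges_on A"
  shows "sum f E = sum f (del_vertex v E) + (\<Sum>u\<in>nbrs E v. f (min u v, max u v))"
proof -
  let ?g = "\<lambda>u. (min u v, max u v)"
  have fin: "finite E" using assms finite_edges_on finite_subset by blast
  have "E = del_vertex v E \<union> ?g ` nbrs E v" "del_vertex v E \<inter> ?g ` nbrs E v = {}"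
    using assms by (force simp: del_vertex_def nbrs_def edges_on_def image_iff min_def max_def)+
  moreover have "inj_on ?g (nbrs E v)"
    by (auto simp: inj_on_def min_def max_def split: if_splits)
  moreover have "finite (nbrs E v)"
    by (rule finite_subset[of _ A]) (use assms in \<open>auto simp: nbrs_def edges_on_def\<close>)
  moreover have "finite (del_vertex v E)"
    using fin by (rule rev_finite_subset) (auto simp: del_vertex_def)
  ultimately show ?thesis
    by (metis (no_types, lifting) finite_imageI sum.reindex_cong sum.union_disjoint)
qed

lemma del_vertex_edges_on:
  "E \<subseteq> edges_on (insert v A) \<Longrightarrow> del_vertex v E \<subseteq> edges_on A"
  by (auto simp: del_vertex_def edges_on_def)

lemma nbrs_edges_on:
  "E \<subseteq> edges_on (insert v A) \<Longrightarrow> nbrs E v \<subseteq> A"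
  by (auto simp: nbrs_def edges_on_def)

lemma card_del_vertex:
  assumes "finite A" "E \<subseteq> edges_on A"
  shows "card E = card (del_vertex v E) + card (nbrs E v)"
  using sum_split_vertex[OF assms, of "\<lambda>_. 1::nat" v] by simp

lemma mono_edges_del_vertex:
  assumes "finite A" "E \<subseteq> edges_on A"
  shows "mono_edges E (y(v := x)) = mono_edges (del_vertex v E) y + card {u \<in> nbrs E v. y u = x}"
proof -
  have fin: "finite (nbrs E v)"
    by (rule finite_subset[of _ A]) (use assms in \<open>auto simp: nbrs_def edges_on_def\<close>)
  have irr: "u \<noteq> v" if "u \<in> nbrs E v" for u
    using that assms by (auto simp: nbrs_def edges_on_def)
  have "(\<Sum>u\<in>nbrs E v. (case (min u v, max u v) of (i, j) \<Rightarrow>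
           of_bool ((y(v := x)) i = (y(v := x)) j))) = (\<Sum>u\<in>nbrs E v. of_bool (y u = x) :: nat)"
    using irr by (intro sum.cong refl) (auto simp: min_def max_def)
  also have "\<dots> = card {u \<in> nbrs E v. y u = x}"
    using fin by (simp add: of_bool_def sum.If_cases Int_def conj_commute)
  finally show ?thesis
    unfolding mono_edges_def
    by (subst sum_split_vertex[OF assms, of _ v])
       (auto intro!: sum.cong simp: del_vertex_def)
qed

text \<open>
  A vertex of minimum degree \<open>d\<close> does it: the degrees sum to twice the number of edges, so
  \<open>d * card A \<le> 2 * card E\<close>, while \<open>d \<le> card A\<close> since neighbours are vertices.
\<close>
lemma ex_low_degree_vertex:
  assumes "finite A" "A \<noteq> {}" "E \<subseteq> edges_on A"
  shows "\<exists>v\<in>A. (card (nbrs E v))\<^sup>2 \<le> 2 * card E"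
proof -
  have lt: "i \<in> A \<and> j \<in> A \<and> i < j" if "(i, j) \<in> E" for i j
    using that assms(3) by (auto simp: edges_on_def)
  have nb: "nbrs E v = {u \<in> A. (v, u) \<in> E} \<union> {u \<in> A. (u, v) \<in> E}" for v
    using lt by (auto simp: nbrs_def)
  have disj: "{u \<in> A. (v, u) \<in> E} \<inter> {u \<in> A. (u, v) \<in> E} = {}" for v
    using lt by (blast dest: less_asym)
  have deg: "card (nbrs E v) = card {u \<in> A. (v, u) \<in> E} + card {u \<in> A. (u, v) \<in> E}" for v
    unfolding nb using assms(1) by (intro card_Un_disjoint disj) auto
  have "(\<Sum>v\<in>A. card {u \<in> A. (v, u) \<in> E}) = card (SIGMA v:A. {u \<in> A. (v, u) \<in> E})"
    using assms(1) by (simp add: card_SigmaI)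
  also have "(SIGMA v:A. {u \<in> A. (v, u) \<in> E}) = E"
    using assms(3) by (auto simp: edges_on_def)
  finally have out: "(\<Sum>v\<in>A. card {u \<in> A. (v, u) \<in> E}) = card E" .
  have "(\<Sum>v\<in>A. card {u \<in> A. (u, v) \<in> E}) = card (SIGMA v:A. {u \<in> A. (u, v) \<in> E})"
    using assms(1) by (simp add: card_SigmaI)
  also have "(SIGMA v:A. {u \<in> A. (u, v) \<in> E}) = E\<inverse>"
    using assms(3) by (auto simp: edges_on_def)
  finally have handshake: "(\<Sum>v\<in>A. card (nbrs E v)) = 2 * card E"
    using out by (simp add: deg sum.distrib card_inverse)
  obtain v where v: "v \<in> A" and min: "\<And>u. u \<in> A \<Longrightarrow> card (nbrs E v) \<le> card (nbrs E u)"
    using ex_min_if_finite[of "(\<lambda>v. card (nbrs E v)) ` A"] assms(1,2)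
    by (metis (no_types, lifting) arg_min_if_finite(1) arg_min_least)
  have "card (nbrs E v) \<le> card A"
    using assms by (intro card_mono) (auto simp: nbrs_def edges_on_def)
  then have "(card (nbrs E v))\<^sup>2 \<le> card A * card (nbrs E v)"
    by (simp add: power2_eq_square)
  also have "\<dots> \<le> (\<Sum>v\<in>A. card (nbrs E v))"
    using sum_bounded_below[of A "card (nbrs E v)" "\<lambda>u. card (nbrs E u)"] min by simp
  finally show ?thesis using v handshake by auto
qed

section \<open>Poisson approximation for a fixed graph\<close>

text \<open>
  Replacing \<open>w ^ m\<close> by its linear interpolation between \<open>m = 0\<close> and \<open>m = 1\<close> costs nothing at these two
  values, and in general at most a multiple of the number of pairs among \<open>m\<close> objects. When \<open>m\<close> is the number
  of new monochromatic edges, the expected number of pairs can be computed.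
\<close>
lemma norm_power_minus_linear:
  fixes w :: complex
  assumes "norm w = 1"
  shows "norm (w ^ m - 1 - of_nat m * (w - 1)) \<le> 2 * (real m ^ 2 - real m)"
proof (induction m)
  case (Suc m)
  have "w ^ Suc m - 1 - of_nat (Suc m) * (w - 1) =
      w * (w ^ m - 1 - of_nat m * (w - 1)) + of_nat m * (w - 1) ^ 2"
    by (simp add: algebra_simps power2_eq_square)
  also have "norm \<dots> \<le> norm (w ^ m - 1 - of_nat m * (w - 1)) + real m * norm (w - 1) ^ 2"
    using assms by (intro norm_triangle_le) (simp add: norm_mult norm_power)
  also have "\<dots> \<le> 2 * (real m ^ 2 - real m) + real m * 2 ^ 2"
    using assms norm_triangle_ineq4[of w 1]
    by (intro add_mono Suc mult_left_mono power_mono) auto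
  also have "\<dots> = 2 * (real (Suc m) ^ 2 - real (Suc m))"
    by (simp add: algebra_simps power2_eq_square)
  finally show ?case .
qed auto

text \<open>
  Taylor's formula on the left half-plane, where the second derivative of \<open>exp\<close> has norm at most 1.
\<close>
lemma norm_exp_minus_linear:
  fixes u :: complex
  assumes "Re u \<le> 0"
  shows "norm (exp u - (1 + u)) \<le> norm u ^ 2"
proof -
  let ?S = "{z. Re z \<le> 0}"
  have "norm (exp u - (\<Sum>i\<le>1. exp 0 * (u - 0) ^ i / fact i)) \<le> 1 * norm (u - 0) ^ Suc 1 / fact 1"
  proof (rule complex_Taylor[of ?S 1 "\<lambda>_. exp"])
    show "convex ?S" by (rule convex_halfspace_Re_le)
  qed (use assms in \<open>auto intro!: derivative_eq_intros\<close>)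
  then show ?thesis by (simp add: power2_eq_square)
qed

lemma sum_card_colour_classes:
  fixes y :: "'a \<Rightarrow> nat"
  assumes "finite S" "\<And>u. u \<in> S \<Longrightarrow> y u \<in> {1..c}"
  shows "(\<Sum>x=1..c. real (card {u \<in> S. y u = x})) = real (card S)"
proof -
  have "S = (\<Union>x\<in>{1..c}. {u \<in> S. y u = x})"
    using assms(2) by blast
  then have "card S = card (\<Union>x\<in>{1..c}. {u \<in> S. y u = x})"
    by simp
  also have "\<dots> = (\<Sum>x=1..c. card {u \<in> S. y u = x})"
    using assms(1) by (intro card_UN_disjoint) auto
  finally have "card S = (\<Sum>x=1..c. card {u \<in> S. y u = x})" .
  then show ?thesis by simp
qed

text \<open>
  If a new vertex with neighbours \<open>S\<close> gets the colour \<open>x\<close>, then \<open>m = card {u \<in> S. y u = x}\<close> of its edges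
  become monochromatic. The sum of \<open>m\<^sup>2 - m\<close> over all colours counts the ordered pairs of distinct
  neighbours that agree in colour, and each pair agrees with probability \<open>1 / c\<close>.
\<close>
lemma expectation_colour_collisions:
  assumes A: "finite A" "S \<subseteq> A" and c: "c > 0"
  shows "measure_pmf.expectation (random_colouring A c)
           (\<lambda>y. \<Sum>x=1..c. real (card {u \<in> S. y u = x}) ^ 2 - real (card {u \<in> S. y u = x})) =
         (real (card S) ^ 2 - real (card S)) / c"
    (is "measure_pmf.expectation ?M ?f = _")
proof -
  have S: "finite S" using A finite_subset by blast
  have fin: "finite (set_pmf ?M)" using A c by (rule_tac finite_random_colouring)
  have "measure_pmf.expectation ?M ?f =
      measure_pmf.expectation ?M (\<lambda>y. \<Sum>u\<in>S. \<Sum>w\<in>S - {u}. of_bool (y u = y w))"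
  proof (intro integral_cong_AE AE_pmfI)
    fix y assume "y \<in> set_pmf ?M"
    then have col: "y u \<in> {1..c}" if "u \<in> S" for u
      using random_colouring_in_colours[of A c y u] A c that by auto
    have card_eq: "real (card {u \<in> S. y u = x}) = (\<Sum>u\<in>S. of_bool (y u = x))" for x
      using S by (simp add: of_bool_def sum.If_cases Int_def conj_commute)
    have "(\<Sum>x=1..c. real (card {u \<in> S. y u = x}) ^ 2) =
        (\<Sum>x=1..c. \<Sum>u\<in>S. \<Sum>w\<in>S. of_bool (y u = x) * of_bool (y w = x))"
      by (simp add: card_eq power2_eq_square sum_product)
    also have "\<dots> = (\<Sum>u\<in>S. \<Sum>w\<in>S. \<Sum>x=1..c. of_bool (y u = x) * of_bool (y w = x))"
      by (subst sum.swap) (intro sum.cong refl sum.swap)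
    also have "\<dots> = (\<Sum>u\<in>S. \<Sum>w\<in>S. of_bool (y u = y w))"
    proof (intro sum.cong refl)
      fix u w assume "u \<in> S"
      have "(\<Sum>x=1..c. of_bool (y u = x) * of_bool (y w = x) :: real) =
          (\<Sum>x=1..c. if x = y u then of_bool (y u = y w) else 0)"
        by (intro sum.cong) auto
      also have "\<dots> = of_bool (y u = y w)"
        using col[OF \<open>u \<in> S\<close>] by (subst sum.delta) auto
      finally show "(\<Sum>x=1..c. of_bool (y u = x) * of_bool (y w = x) :: real) = of_bool (y u = y w)" .
    qed
    also have "\<dots> = (\<Sum>u\<in>S. 1 + (\<Sum>w\<in>S - {u}. of_bool (y u = y w)))"
      using S by (intro sum.cong refl) (subst sum.remove, auto)
    finally show "?f y = (\<Sum>u\<in>S. \<Sum>w\<in>S - {u}. of_bool (y u = y w))"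
      using sum_card_colour_classes[of S y c] S col by (simp add: sum_subtractf sum.distrib)
  qed auto
  also have "\<dots> = (\<Sum>u\<in>S. \<Sum>w\<in>S - {u}. measure_pmf.expectation ?M (\<lambda>y. of_bool (y u = y w)))"
    using fin by (simp add: integrable_measure_pmf_finite)
  also have "\<dots> = (\<Sum>u\<in>S. \<Sum>w\<in>S - {u}. 1 / real c)"
    using A c by (intro sum.cong refl expectation_same_colour) auto
  also have "\<dots> = (real (card S) ^ 2 - real (card S)) / c"
  proof (cases "S = {}")
    case False
    then have "card S \<ge> 1" using S by (simp add: Suc_leI card_gt_0_iff)
    then show ?thesis
      using S by (simp add: card_Diff_singleton of_nat_diff power2_eq_square algebra_simps diff_divide_distrib)
  qed simp
  finally show ?thesis .
qed

text \<open>
  One step of the approximation. Whatever the colouring of \<open>A\<close>, the new vertex \<open>v\<close> creates on average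
  exactly \<open>d / c\<close> monochromatic edges. It creates two or more of them only if two neighbours of \<open>v\<close>
  share its colour, which has probability of order \<open>d\<^sup>2 / c\<^sup>2\<close>. Up to this error, passing from \<open>A\<close> to
  \<open>insert v A\<close> multiplies the generating function by \<open>1 + (w - 1) * d / c\<close>.
\<close>
lemma expectation_power_mono_edges_insert:
  fixes w :: complex
  assumes A: "finite A" "v \<notin> A" and E: "E \<subseteq> edges_on (insert v A)"
    and c: "c > 0" and w: "norm w = 1"
  defines "d \<equiv> card (nbrs E v)"
  shows "norm (measure_pmf.expectation (random_colouring (insert v A) c) (\<lambda>y. w ^ mono_edges E y) -
           (1 + (w - 1) * of_real (d / c)) *
           measure_pmf.expectation (random_colouring A c) (\<lambda>y. w ^ mono_edges (del_vertex v E) y))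
         \<le> 2 * real d ^ 2 / real c ^ 2"
proof -
  let ?M = "random_colouring A c" and ?S = "nbrs E v" and ?N = "mono_edges (del_vertex v E)"
  let ?m = "\<lambda>y x. card {u \<in> ?S. y u = x}"
  have SA: "?S \<subseteq> A" using E by (rule nbrs_edges_on)
  have S: "finite ?S" using SA A finite_subset by blast
  have fin: "finite (set_pmf ?M)" using A c by (rule_tac finite_random_colouring)
  note [simp] = integrable_measure_pmf_finite[OF fin]
  have "measure_pmf.expectation (random_colouring (insert v A) c) (\<lambda>y. w ^ mono_edges E y) =
      measure_pmf.expectation ?M (\<lambda>y. (\<Sum>x=1..c. w ^ (?N y + ?m y x)) /\<^sub>R real c)"
    using A c E by (subst expectation_random_colouring_insert)
      (simp_all add: mono_edges_del_vertex[of "insert v A"])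
  then have "norm (measure_pmf.expectation (random_colouring (insert v A) c) (\<lambda>y. w ^ mono_edges E y) -
           (1 + (w - 1) * of_real (d / c)) * measure_pmf.expectation ?M (\<lambda>y. w ^ ?N y)) =
      norm (measure_pmf.expectation ?M (\<lambda>y. (\<Sum>x=1..c. w ^ (?N y + ?m y x)) /\<^sub>R real c -
           (1 + (w - 1) * of_real (d / c)) * w ^ ?N y))"
    by simp
  also have "\<dots> \<le> measure_pmf.expectation ?M (\<lambda>y. norm ((\<Sum>x=1..c. w ^ (?N y + ?m y x)) /\<^sub>R real c -
           (1 + (w - 1) * of_real (d / c)) * w ^ ?N y))"
    by (rule integral_norm_bound)
  also have "\<dots> \<le> measure_pmf.expectation ?M
      (\<lambda>y. 2 / c * (\<Sum>x=1..c. real (?m y x) ^ 2 - real (?m y x)))"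
  proof (intro integral_mono_AE AE_pmfI)
    fix y assume "y \<in> set_pmf ?M"
    then have col: "y u \<in> {1..c}" if "u \<in> ?S" for u
      using random_colouring_in_colours[of A c y u] A c that SA by auto
    have d: "(\<Sum>x=1..c. of_nat (?m y x)) = (of_nat d :: complex)"
      using arg_cong[OF sum_card_colour_classes[of ?S y c], of complex_of_real] S col
      unfolding d_def by simp
    have "(\<Sum>x=1..c. w ^ (?N y + ?m y x)) /\<^sub>R real c - (1 + (w - 1) * of_real (d / c)) * w ^ ?N y =
        w ^ ?N y / of_nat c * ((\<Sum>x=1..c. w ^ ?m y x) - (of_nat c + of_nat d * (w - 1)))"
      using c by (simp add: power_add scaleR_conv_of_real field_simps flip: sum_distrib_left)
    also have "(\<Sum>x=1..c. w ^ ?m y x) - (of_nat c + of_nat d * (w - 1)) =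
        (\<Sum>x=1..c. w ^ ?m y x - 1 - of_nat (?m y x) * (w - 1))"
      by (simp add: sum_subtractf d[unfolded One_nat_def] flip: sum_distrib_right)
    finally have "norm ((\<Sum>x=1..c. w ^ (?N y + ?m y x)) /\<^sub>R real c -
        (1 + (w - 1) * of_real (d / c)) * w ^ ?N y) =
        norm (\<Sum>x=1..c. w ^ ?m y x - 1 - of_nat (?m y x) * (w - 1)) / c"
      using w by (simp add: norm_mult norm_power norm_divide)
    also have "\<dots> \<le> (\<Sum>x=1..c. 2 * (real (?m y x) ^ 2 - real (?m y x))) / c"
      using norm_power_minus_linear[OF w] by (intro divide_right_mono sum_norm_le) auto
    also have "\<dots> = 2 / c * (\<Sum>x=1..c. real (?m y x) ^ 2 - real (?m y x))"
      by (simp only: sum_distrib_left[symmetric] times_divide_eq_left)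
    finally show "norm ((\<Sum>x=1..c. w ^ (?N y + ?m y x)) /\<^sub>R real c -
        (1 + (w - 1) * of_real (d / c)) * w ^ ?N y) \<le>
        2 / c * (\<Sum>x=1..c. real (?m y x) ^ 2 - real (?m y x))" .
  qed auto
  also have "\<dots> = 2 / c * ((real d ^ 2 - real d) / c)"
    unfolding d_def by (simp only: integral_mult_right_zero expectation_colour_collisions[OF A(1) SA c])
  also have "\<dots> \<le> 2 * real d ^ 2 / real c ^ 2"
    by (simp add: power2_eq_square divide_right_mono)
  finally show ?thesis .
qed

text \<open>
  Peel off vertices of low degree. Each step costs an error of at most \<open>6 * d\<^sup>2 / c\<^sup>2\<close>, one third of it
  from the conditional law of the new edges and the rest from replacing \<open>1 + u\<close> by \<open>exp u\<close>. Since
  \<open>d \<le> sqrt (2 * card E)\<close> at each step and the degrees at removal add up to \<open>card E\<close>, the total is at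
  most \<open>6 * card E * sqrt (2 * card E) / c\<^sup>2\<close>. When \<open>card E\<close> is of order \<open>c\<close> this is of order
  \<open>1 / sqrt c\<close>. A removal order without control of the degrees would not do: for a star whose centre is
  removed first, the sum of the \<open>d\<^sup>2\<close> is \<open>(card E)\<^sup>2\<close>.
\<close>
lemma poisson_approximation:
  fixes w :: complex
  assumes "finite A" "E \<subseteq> edges_on A" and c: "c > 0" and w: "norm w = 1"
  shows "norm (measure_pmf.expectation (random_colouring A c) (\<lambda>y. w ^ mono_edges E y) -
           exp ((w - 1) * of_real (card E / c))) \<le> 6 * real (card E) * sqrt (2 * card E) / real c ^ 2"
  using assms(1,2)
proof (induction "card A" arbitrary: A E)
  case 0
  then have "E = {}" by (auto simp: edges_on_def)
  then show ?case by (simp add: mono_edges_def)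
next
  case (Suc n)
  have "A \<noteq> {}" using Suc.hyps(2) by auto
  then obtain v where v: "v \<in> A" "(card (nbrs E v))\<^sup>2 \<le> 2 * card E"
    using ex_low_degree_vertex[OF Suc.prems(1) _ Suc.prems(2)] by blast
  let ?B = "A - {v}" and ?E' = "del_vertex v E"
  have A: "A = insert v ?B" "finite ?B" "v \<notin> ?B" "card ?B = n"
    using v Suc.hyps Suc.prems by auto
  have E: "E \<subseteq> edges_on (insert v ?B)" using Suc.prems A(1) by simp
  define d m m' where "d = card (nbrs E v)" and "m = card E" and "m' = card ?E'"
  have m: "m = m' + d"
    unfolding d_def m_def m'_def by (rule card_del_vertex[OF Suc.prems])
  let ?X = "measure_pmf.expectation (random_colouring A c) (\<lambda>y. w ^ mono_edges E y)"
  let ?X' = "measure_pmf.expectation (random_colouring ?B c) (\<lambda>y. w ^ mono_edges ?E' y)"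
  let ?e = "\<lambda>k::nat. exp ((w - 1) * of_real (k / c))"
  have Re: "Re w \<le> 1" using complex_Re_le_cmod[of w] w by simp
  have IH: "norm (?X' - ?e m') \<le> 6 * real m' * sqrt (2 * m') / real c ^ 2"
    unfolding m'_def by (rule Suc.hyps(1)) (use A del_vertex_edges_on[OF E] in auto)
  have step: "norm (?X - (1 + (w - 1) * of_real (d / c)) * ?X') \<le> 2 * real d ^ 2 / real c ^ 2"
    using expectation_power_mono_edges_insert[OF A(2,3) E c w] A(1) unfolding d_def by simp
  have X': "norm ?X' \<le> 1"
  proof -
    have "norm ?X' \<le> measure_pmf.expectation (random_colouring ?B c) (\<lambda>y. norm (w ^ mono_edges ?E' y))"
      by (rule integral_norm_bound)
    then show ?thesis using w by (simp add: norm_power)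
  qed
  have "norm (?e d - (1 + (w - 1) * of_real (d / c))) \<le> norm ((w - 1) * of_real (d / c)) ^ 2"
    using Re by (intro norm_exp_minus_linear) (auto simp: mult_nonpos_nonneg divide_nonpos_nonneg)
  also have "\<dots> = norm (w - 1) ^ 2 * (d / c) ^ 2"
    by (simp add: norm_mult norm_divide power_mult_distrib power_divide)
  also have "\<dots> \<le> 2 ^ 2 * (d / c) ^ 2"
    using norm_triangle_ineq4[of w 1] w by (intro mult_right_mono power_mono) auto
  finally have ex: "norm (?e d - (1 + (w - 1) * of_real (d / c))) \<le> 4 * real d ^ 2 / real c ^ 2"
    by (simp add: power_divide)
  have ed: "norm (?e d) \<le> 1"
    using Re by (auto simp: mult_nonpos_nonneg divide_nonpos_nonneg)
  have em: "?e m = ?e d * ?e m'"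
    unfolding m by (simp add: exp_add[symmetric] algebra_simps add_divide_distrib)
  \<comment> \<open>The three errors come from the one-vertex step, from replacing the linear factor by an exponential,
    and from the smaller graph.\<close>
  have triangle: "norm (p - q * r + s * t) \<le> norm p + norm q * norm r + norm s * norm t"
    for p q r s t :: complex
    using norm_triangle_ineq[of "p - q * r" "s * t"] norm_triangle_ineq4[of p "q * r"]
    by (simp add: norm_mult)
  have "?X - ?e m = (?X - (1 + (w - 1) * of_real (d / c)) * ?X') -
      (?e d - (1 + (w - 1) * of_real (d / c))) * ?X' + ?e d * (?X' - ?e m')"
    unfolding em by (simp add: algebra_simps)
  also have "norm \<dots> \<le> norm (?X - (1 + (w - 1) * of_real (d / c)) * ?X') +
      norm (?e d - (1 + (w - 1) * of_real (d / c))) * norm ?X' + norm (?e d) * norm (?X' - ?e m')"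
    by (rule triangle)
  also have "\<dots> \<le> 2 * real d ^ 2 / real c ^ 2 + 4 * real d ^ 2 / real c ^ 2 * 1 +
      1 * (6 * real m' * sqrt (2 * m') / real c ^ 2)"
    by (intro add_mono mult_mono step ex X' ed IH) auto
  also have "\<dots> = (6 * real d ^ 2 + 6 * real m' * sqrt (2 * m')) / real c ^ 2"
    by (simp add: add_divide_distrib)
  also have "\<dots> \<le> 6 * real m * sqrt (2 * m) / real c ^ 2"
  proof (intro divide_right_mono)
    have "real (d\<^sup>2) \<le> real (2 * m)"
      using v unfolding d_def m_def by (subst of_nat_le_iff)
    then have "real d \<le> sqrt (2 * m)" by (intro real_le_rsqrt) simp
    then have "6 * real d * real d + 6 * real m' * sqrt (2 * m') \<le>
        6 * real d * sqrt (2 * m) + 6 * real m' * sqrt (2 * m)"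
      using m by (intro add_mono mult_left_mono) auto
    then show "6 * real d ^ 2 + 6 * real m' * sqrt (2 * m') \<le> 6 * real m * sqrt (2 * m)"
      by (simp add: m power2_eq_square algebra_simps)
  qed auto
  finally show ?case unfolding m_def .
qed

section \<open>Concentration for a fixed graph\<close>

text \<open>
  The events that two given edges are monochromatic are independent even if the edges share a vertex, so
  the variance is that of a binomial variable. The proof adds vertices one at a time: the
  conditional mean \<open>d / c\<close> of the increment does not depend on the previous colours, hence
  the cross terms vanish.
\<close>
lemma variance_mono_edges_le:
  assumes "finite A" "E \<subseteq> edges_on A" and c: "c > 0"
  shows "measure_pmf.expectation (random_colouring A c) (\<lambda>y. (real (mono_edges E y) - card E / c) ^ 2)
           \<le> card E / c"
  using assms(1,2)
proof (induction A arbitrary: E rule: finite_induct)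
  case empty
  then have "E = {}" by (auto simp: edges_on_def)
  then show ?case by (simp add: mono_edges_def)
next
  case (insert v A)
  note E = insert.prems
  let ?M = "random_colouring A c" and ?S = "nbrs E v" and ?E' = "del_vertex v E"
  let ?m = "\<lambda>y x. card {u \<in> ?S. y u = x}"
  define d m m' where "d = card ?S" and "m = card E" and "m' = card ?E'"
  let ?a = "\<lambda>y. real (mono_edges ?E' y) - m' / c"
  have m: "m = m' + d"
    unfolding d_def m_def m'_def by (rule card_del_vertex[OF _ E]) (use insert.hyps in simp)
  have SA: "?S \<subseteq> A" using E by (rule nbrs_edges_on)
  have S: "finite ?S" using SA insert.hyps finite_subset by blast
  have fin: "finite (set_pmf ?M)" using insert.hyps c by (rule_tac finite_random_colouring)
  note [simp] = integrable_measure_pmf_finite[OF fin]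
  have "measure_pmf.expectation (random_colouring (insert v A) c)
          (\<lambda>y. (real (mono_edges E y) - m / c) ^ 2) =
      measure_pmf.expectation ?M (\<lambda>y. (\<Sum>x=1..c. (?a y + (real (?m y x) - d / c)) ^ 2) /\<^sub>R real c)"
    using insert.hyps c E by (subst expectation_random_colouring_insert)
      (simp_all add: mono_edges_del_vertex[of "insert v A"] m add_divide_distrib algebra_simps)
  also have "\<dots> = measure_pmf.expectation ?M (\<lambda>y. (?a y) ^ 2 +
      (\<Sum>x=1..c. real (?m y x) ^ 2 - real (?m y x)) / c + (d / c - (d / c) ^ 2))"
  proof (intro integral_cong_AE AE_pmfI)
    \<comment> \<open>Here \<open>a\<close> is the deviation before \<open>v\<close> is added, \<open>k\<close> the number of new monochromatic edges and
      \<open>b = d / c\<close> its mean; only \<open>k\<close> depends on the colour of \<open>v\<close>.\<close>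
    have square: "(a + (k - b)) ^ 2 = a ^ 2 + (k ^ 2 - k) + ((1 + 2 * a - 2 * b) * k + (b ^ 2 - 2 * a * b))"
      for a b k :: real
      by (simp add: power2_eq_square algebra_simps)
    have average: "(k * a ^ 2 + s + ((1 + 2 * a - 2 * b) * (k * b) + k * (b ^ 2 - 2 * a * b))) / k =
        a ^ 2 + s / k + (b - b ^ 2)" if "k > 0" for k a s b :: real
      using that by (simp add: field_simps power2_eq_square)
    fix y assume "y \<in> set_pmf ?M"
    then have col: "y u \<in> {1..c}" if "u \<in> ?S" for u
      using random_colouring_in_colours[of A c y u] insert.hyps c that SA by auto
    have d: "(\<Sum>x=1..c. real (?m y x)) = d"
      using sum_card_colour_classes[OF S col] unfolding d_def by simp
    have "(\<Sum>x=1..c. (?a y + (real (?m y x) - d / c)) ^ 2) =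
        (\<Sum>x=1..c. (?a y) ^ 2 + (real (?m y x) ^ 2 - real (?m y x)) +
           ((1 + 2 * ?a y - 2 * (d / c)) * real (?m y x) + ((d / c) ^ 2 - 2 * ?a y * (d / c))))"
      by (simp only: square)
    also have "\<dots> = c * (?a y) ^ 2 + (\<Sum>x=1..c. real (?m y x) ^ 2 - real (?m y x)) +
           ((1 + 2 * ?a y - 2 * (d / c)) * (c * (d / c)) + c * ((d / c) ^ 2 - 2 * ?a y * (d / c)))"
      by (simp only: sum.distrib sum_distrib_left[symmetric] d) (use c in simp)
    finally show "(\<Sum>x=1..c. (?a y + (real (?m y x) - d / c)) ^ 2) /\<^sub>R real c =
        (?a y) ^ 2 + (\<Sum>x=1..c. real (?m y x) ^ 2 - real (?m y x)) / c + (d / c - (d / c) ^ 2)"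
      using average[of "real c" "?a y" "\<Sum>x=1..c. real (?m y x) ^ 2 - real (?m y x)" "d / c"] c
      by (simp only: scaleR_conv_of_real of_real_eq_id id_apply inverse_eq_divide
          times_divide_eq_left mult_1_left of_nat_0_less_iff)
  qed auto
  also have "\<dots> = measure_pmf.expectation ?M (\<lambda>y. (?a y) ^ 2) + (real d ^ 2 - real d) / c / c
      + (d / c - (d / c) ^ 2)"
    unfolding d_def using expectation_colour_collisions[OF insert.hyps(1) SA c] by simp
  also have "\<dots> \<le> m' / c + (real d ^ 2 - real d) / c / c + (d / c - (d / c) ^ 2)"
    using insert.IH[OF del_vertex_edges_on[OF E]] unfolding m'_def by simp
  also have "\<dots> = m / c - real d / c ^ 2"
    using c by (simp add: m field_simps power2_eq_square)
  also have "\<dots> \<le> m / c" by simp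
  finally show ?case unfolding m_def .
qed

text \<open>
  Chebyshev's inequality: the mean \<open>card E / c\<close> also bounds the variance, and the event forces a
  deviation of at least half the mean.
\<close>
lemma prob_few_mono_edges_le:
  assumes A: "finite A" "E \<subseteq> edges_on A" and c: "c > 0"
    and K: "2 * K \<le> card E / c" and pos: "card E > 0"
  shows "measure_pmf.prob (random_colouring A c) {y. real (mono_edges E y) \<le> K} \<le> 4 / (card E / c)"
proof -
  let ?M = "random_colouring A c" and ?X = "\<lambda>y. (real (mono_edges E y) - card E / c) ^ 2"
  define \<mu> where "\<mu> = card E / c"
  have \<mu>: "\<mu> > 0" using pos c by (simp add: \<mu>_def)
  have fin: "finite (set_pmf ?M)" using A c by (rule_tac finite_random_colouring)
  have "measure_pmf.prob ?M {y. real (mono_edges E y) \<le> K} \<le>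
      measure_pmf.prob ?M {y \<in> space ?M. ?X y \<ge> (\<mu> / 2) ^ 2}"
  proof (intro measure_pmf.finite_measure_mono subsetI)
    fix y assume "y \<in> {y. real (mono_edges E y) \<le> K}"
    then have "\<mu> / 2 \<le> \<mu> - real (mono_edges E y)" using K by (simp add: \<mu>_def)
    then have "(\<mu> / 2) ^ 2 \<le> (\<mu> - real (mono_edges E y)) ^ 2"
      using \<mu> by (intro power_mono) auto
    then show "y \<in> {y \<in> space ?M. ?X y \<ge> (\<mu> / 2) ^ 2}"
      by (simp add: \<mu>_def power2_commute)
  qed simp
  also have "\<dots> \<le> measure_pmf.expectation ?M ?X / (\<mu> / 2) ^ 2"
    using \<mu> by (intro integral_Markov_inequality_measure[where A = "{}"] integrable_measure_pmf_finite fin) auto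
  also have "\<dots> \<le> \<mu> / (\<mu> / 2) ^ 2"
    using variance_mono_edges_le[OF A c] by (intro divide_right_mono) (simp_all add: \<mu>_def)
  also have "\<dots> = 4 / \<mu>" using \<mu> by (simp add: power2_eq_square)
  finally show ?thesis unfolding \<mu>_def .
qed

section \<open>Averaging over the random graph\<close>

lemma uniform_colouring_eq: "uniform_colouring n c = random_colouring {1..n} c"
  by (simp add: uniform_colouring_def random_colouring_def)

lemma simple_graphs_eq: "simple_graphs n = Pow (edges_on {1..n})"
  by (auto simp: simple_graphs_def edges_on_def)

lemma finite_set_pmf_simple_graphs:
  "set_pmf p \<subseteq> simple_graphs n \<Longrightarrow> finite (set_pmf p)"
  using finite_edges_on[of "{1..n}"] by (auto simp: simple_graphs_eq intro: finite_subset)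

lemma real_distribution_distr_pmf: "real_distribution (distr (measure_pmf p) borel f)"
  by (intro prob_space.real_distribution_distr) (simp_all add: prob_space_measure_pmf)

lemma expectation_coloured_graph:
  fixes f :: "(nat \<times> nat) set \<times> (nat \<Rightarrow> nat) \<Rightarrow> 'b :: {banach, second_countable_topology}"
  assumes "set_pmf p \<subseteq> simple_graphs n" "c > 0"
  shows "measure_pmf.expectation (coloured_graph n c p) f =
    measure_pmf.expectation p (\<lambda>E. measure_pmf.expectation (random_colouring {1..n} c) (\<lambda>y. f (E, y)))"
proof -
  show ?thesis
    using assms(2) finite_set_pmf_simple_graphs[OF assms(1)] finite_random_colouring[of "{1..n}" c]
    by (simp add: coloured_graph_def uniform_colouring_eq expectation_pair_pmf_finite)
qed

lemma iexp_times_nat: "iexp (t * real k) = iexp t ^ k"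
  by (simp add: mult_ac flip: exp_of_nat_mult)

lemma char_mono_edges_coloured_graph:
  assumes "set_pmf p \<subseteq> simple_graphs n" "c > 0"
  shows "char (distr (coloured_graph n c p) borel (\<lambda>(E, y). real (mono_edges E y))) t =
    measure_pmf.expectation p (\<lambda>E. measure_pmf.expectation (random_colouring {1..n} c)
      (\<lambda>y. iexp t ^ mono_edges E y))"
proof -
  have "char (distr (coloured_graph n c p) borel (\<lambda>(E, y). real (mono_edges E y))) t =
      measure_pmf.expectation (coloured_graph n c p) (\<lambda>z. iexp t ^ (case z of (E, y) \<Rightarrow> mono_edges E y))"
    unfolding char_def by (subst integral_distr) (auto simp: case_prod_beta iexp_times_nat[symmetric])
  then show ?thesis using assms by (simp add: expectation_coloured_graph)
qed

text \<open>
  The bound for a fixed graph, with \<open>card E\<close> written as \<open>c * D E\<close>, is \<open>6 * sqrt 2 / sqrt c\<close> times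
  \<open>D E * sqrt (D E)\<close>. Truncating it at 2, which bounds the distance of any two points of the unit disc,
  makes it a bounded continuous function of \<open>D E\<close>, so that it can be integrated in the weak limit
  even when \<open>D E\<close> has no finite moments. The absolute values keep the
  exponential bounded on the negative half-line.
\<close>
lemma char_mono_edges_mixed_poisson_bound:
  fixes c :: nat
  assumes G: "set_pmf p \<subseteq> simple_graphs n" and c: "c > 0" and a: "6 * sqrt 2 / sqrt c \<le> a"
  defines "D \<equiv> \<lambda>E :: (nat \<times> nat) set. real (card E) / real c"
  shows "norm (char (distr (coloured_graph n c p) borel (\<lambda>(E, y). real (mono_edges E y))) t -
           measure_pmf.expectation p (\<lambda>E. exp ((iexp t - 1) * of_real \<bar>D E\<bar>)))
         \<le> measure_pmf.expectation p (\<lambda>E. min 2 (a * (\<bar>D E\<bar> * sqrt \<bar>D E\<bar>)))"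
proof -
  let ?X = "\<lambda>E. measure_pmf.expectation (random_colouring {1..n} c) (\<lambda>y. iexp t ^ mono_edges E y)"
  let ?e = "\<lambda>E. exp ((iexp t - 1) * of_real \<bar>D E\<bar>)"
  note [simp] = integrable_measure_pmf_finite[OF finite_set_pmf_simple_graphs[OF G]]
  have a0: "a \<ge> 0" using a by (rule order_trans[rotated]) simp
  have Re: "Re (iexp t) \<le> 1" by (simp add: Re_exp)
  have D: "D E \<ge> 0" for E by (simp add: D_def)
  have "norm (measure_pmf.expectation p ?X - measure_pmf.expectation p ?e) =
      norm (measure_pmf.expectation p (\<lambda>E. ?X E - ?e E))"
    by simp
  also have "\<dots> \<le> measure_pmf.expectation p (\<lambda>E. norm (?X E - ?e E))"
    by (rule integral_norm_bound)
  also have "\<dots> \<le> measure_pmf.expectation p (\<lambda>E. min 2 (a * (\<bar>D E\<bar> * sqrt \<bar>D E\<bar>)))"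
  proof (intro integral_mono_AE AE_pmfI)
    fix E assume "E \<in> set_pmf p"
    then have E: "E \<subseteq> edges_on {1..n}" using G by (auto simp: simple_graphs_eq)
    have "norm (?X E) \<le> measure_pmf.expectation (random_colouring {1..n} c) (\<lambda>y. norm (iexp t ^ mono_edges E y))"
      by (rule integral_norm_bound)
    then have "norm (?X E) \<le> 1" by (simp add: norm_power)
    moreover have "norm (?e E) \<le> 1"
      using Re D[of E] by (auto simp: mult_nonpos_nonneg)
    ultimately have "norm (?X E - ?e E) \<le> 2"
      using norm_triangle_ineq4[of "?X E" "?e E"] by linarith
    moreover have "norm (?X E - ?e E) \<le> 6 * real (card E) * sqrt (2 * card E) / real c ^ 2"
      using poisson_approximation[OF _ E c, of "iexp t"] D[of E] by (simp add: D_def)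
    moreover have "6 * real (card E) * sqrt (2 * card E) / real c ^ 2 =
        6 * sqrt 2 / sqrt c * (D E * sqrt (D E))"
    proof -
      have cc: "sqrt (real c) * sqrt (real c) = real c" by simp
      have "6 * real (card E) * (sqrt 2 * s) / real c ^ 2 = 6 * sqrt 2 / r * (real (card E) / c * (s / r))"
        if "r * r = real c" for r s
        using c that by (auto simp: field_simps power2_eq_square)
      from this[OF cc, of "sqrt (card E)"] show ?thesis
        by (simp add: D_def real_sqrt_mult real_sqrt_divide)
    qed
    moreover have "6 * sqrt 2 / sqrt c * (D E * sqrt (D E)) \<le> a * (D E * sqrt (D E))"
      using a D by (intro mult_right_mono) auto
    ultimately show "norm (?X E - ?e E) \<le> min 2 (a * (\<bar>D E\<bar> * sqrt \<bar>D E\<bar>))"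
      using D[of E] by simp
  qed auto
  finally show ?thesis
    using char_mono_edges_coloured_graph[OF G c] by simp
qed

lemma truncated_integral_tendsto_0:
  assumes "real_distribution \<nu>"
  shows "(\<lambda>k. LINT x|\<nu>. min 2 (1 / real (Suc k) * (\<bar>x\<bar> * sqrt \<bar>x\<bar>))) \<longlonglongrightarrow> 0"
proof -
  interpret real_distribution \<nu> by fact
  have "(\<lambda>k. LINT x|\<nu>. min 2 (1 / real (Suc k) * (\<bar>x\<bar> * sqrt \<bar>x\<bar>))) \<longlonglongrightarrow> (LINT x|\<nu>. 0)"
  proof (rule integral_dominated_convergence[where w = "\<lambda>_. 2"])
    have "(\<lambda>k. min 2 (1 / real (Suc k) * (\<bar>x\<bar> * sqrt \<bar>x\<bar>))) \<longlonglongrightarrow> min 2 (0 * (\<bar>x\<bar> * sqrt \<bar>x\<bar>))" for x :: real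
      by (intro tendsto_intros LIMSEQ_Suc[OF lim_1_over_n])
    then show "AE x in \<nu>. (\<lambda>k. min 2 (1 / real (Suc k) * (\<bar>x\<bar> * sqrt \<bar>x\<bar>))) \<longlonglongrightarrow> 0" by simp
  qed auto
  then show ?thesis by simp
qed

text \<open>
  Both the main term and the error bound are integrals of bounded continuous functions against the law of
  the normalised number of edges, so weak convergence applies to each. The error
  bound with a fixed constant \<open>a\<close> has a limit that tends to 0 with \<open>a\<close>, and the constant actually needed
  at stage \<open>n\<close> is eventually below any \<open>a > 0\<close> because the number of colours tends to infinity.
\<close>
lemma char_mono_edges_tendsto_mixed_poisson:
  fixes G :: "nat \<Rightarrow> (nat \<times> nat) set pmf" and c :: "nat \<Rightarrow> nat"
  assumes G: "\<And>n. n \<ge> 1 \<Longrightarrow> set_pmf (G n) \<subseteq> simple_graphs n"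
    and c_pos: "\<And>n. n \<ge> 1 \<Longrightarrow> c n > 0"
    and c_lim: "filterlim c at_top sequentially"
    and \<nu>: "real_distribution \<nu>"
    and conv: "weak_conv_m (\<lambda>n. distr (G n) borel (\<lambda>E. real (card E) / real (c n))) \<nu>"
  shows "(\<lambda>n. char (distr (coloured_graph n (c n) (G n)) borel (\<lambda>(E, y). real (mono_edges E y))) t)
           \<longlonglongrightarrow> (CLINT x|\<nu>. exp ((iexp t - 1) * of_real \<bar>x\<bar>))"
proof -
  let ?D = "\<lambda>n E. real (card E) / real (c n)"
  let ?h = "\<lambda>x :: real. exp ((iexp t - 1) * complex_of_real \<bar>x\<bar>)"
  let ?g = "\<lambda>a x. min 2 (a * (\<bar>x\<bar> * sqrt \<bar>x\<bar>)) :: real"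
  let ?\<phi> = "\<lambda>n. char (distr (coloured_graph n (c n) (G n)) borel (\<lambda>(E, y). real (mono_edges E y))) t"
  let ?H = "\<lambda>n. measure_pmf.expectation (G n) (\<lambda>E. ?h (?D n E))"
  have Re: "Re (iexp t) \<le> 1" by (simp add: Re_exp)
  have H: "?H \<longlonglongrightarrow> (CLINT x|\<nu>. ?h x)"
  proof -
    have "(\<lambda>n. CLINT x|distr (G n) borel (?D n). ?h x) \<longlonglongrightarrow> (CLINT x|\<nu>. ?h x)"
    proof (rule weak_conv_imp_integral_bdd_continuous_conv[OF real_distribution_distr_pmf \<nu> conv])
      show "isCont ?h x" for x by (intro continuous_intros)
      show "norm (?h x) \<le> 1" for x using Re by (auto simp: mult_nonpos_nonneg)
    qed
    then show ?thesis by (simp add: integral_distr)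
  qed
  have "(\<lambda>n. ?\<phi> n - ?H n) \<longlonglongrightarrow> 0"
  proof (rule LIMSEQ_I)
    fix \<epsilon> :: real assume "\<epsilon> > 0"
    then obtain k where k: "(LINT x|\<nu>. ?g (1 / real (Suc k)) x) < \<epsilon>"
      using order_tendstoD(2)[OF truncated_integral_tendsto_0[OF \<nu>], of \<epsilon>]
      by (auto simp: eventually_sequentially)
    let ?a = "1 / real (Suc k)"
    have "(\<lambda>n. LINT x|distr (G n) borel (?D n). ?g ?a x) \<longlonglongrightarrow> (LINT x|\<nu>. ?g ?a x)"
    proof (rule weak_conv_imp_integral_bdd_continuous_conv[OF real_distribution_distr_pmf \<nu> conv])
      show "isCont (?g ?a) x" for x by (intro continuous_intros)
      show "norm (?g ?a x) \<le> 2" for x by (auto simp: min_def)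
    qed
    then have "(\<lambda>n. measure_pmf.expectation (G n) (\<lambda>E. ?g ?a (?D n E))) \<longlonglongrightarrow> (LINT x|\<nu>. ?g ?a x)"
      by (subst (asm) integral_distr) simp_all
    then have 1: "\<forall>\<^sub>F n in sequentially. measure_pmf.expectation (G n) (\<lambda>E. ?g ?a (?D n E)) < \<epsilon>"
      using k by (rule order_tendstoD(2))
    have "filterlim (\<lambda>n. sqrt (real (c n))) at_top sequentially"
      by (intro filterlim_compose[OF sqrt_at_top] filterlim_compose[OF filterlim_real_sequentially] c_lim)
    then have "(\<lambda>n. 6 * sqrt 2 / sqrt (real (c n))) \<longlonglongrightarrow> 0"
      by (intro tendsto_divide_0[OF tendsto_const] filterlim_at_top_imp_at_infinity)
    then have 2: "\<forall>\<^sub>F n in sequentially. 6 * sqrt 2 / sqrt (real (c n)) < ?a"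
      by (rule order_tendstoD(2)) simp
    have "\<forall>\<^sub>F n in sequentially. norm (?\<phi> n - ?H n - 0) < \<epsilon>"
      using 1 2 eventually_ge_at_top[of 1]
    proof eventually_elim
      case (elim n)
      have "norm (?\<phi> n - ?H n) \<le> measure_pmf.expectation (G n) (\<lambda>E. ?g ?a (?D n E))"
        by (rule char_mono_edges_mixed_poisson_bound[OF G[OF elim(3)] c_pos[OF elim(3)]]) (use elim(2) in simp)
      then show ?case using elim(1) by simp
    qed
    then show "\<exists>no. \<forall>n\<ge>no. norm (?\<phi> n - ?H n - 0) < \<epsilon>"
      by (simp add: eventually_sequentially)
  qed
  from tendsto_add[OF this H] show ?thesis by simp
qed

section \<open>Mixed Poisson laws\<close>

text \<open>
  The Poisson weights with parameter \<open>Z \<omega>\<close> are nonnegative and sum to 1 for almost every \<open>\<omega>\<close>, so summation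
  and integration may be exchanged, both in the total mass and in the characteristic function.
\<close>
lemma ex_mixed_poisson_pmf:
  fixes Z :: "'a \<Rightarrow> real"
  assumes "prob_space \<Omega>" and [measurable]: "Z \<in> borel_measurable \<Omega>" and nonneg: "AE \<omega> in \<Omega>. Z \<omega> \<ge> 0"
  shows "\<exists>W :: nat pmf. (\<forall>k. pmf W k = 1 / fact k * (LINT \<omega>|\<Omega>. exp (- Z \<omega>) * Z \<omega> ^ k)) \<and>
    (\<forall>t. char (distr (measure_pmf W) borel real) t =
       (CLINT \<omega>|\<Omega>. exp ((iexp t - 1) * of_real (Z \<omega>))))"
proof -
  interpret prob_space \<Omega> by fact
  \<comment> \<open>The weight of \<open>k\<close> in the Poisson law with parameter \<open>Z \<omega>\<close>.\<close>
  define f where "f k \<omega> = exp (- Z \<omega>) * Z \<omega> ^ k / fact k" for k \<omega>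
  define p where "p k = (LINT \<omega>|\<Omega>. f k \<omega>)" for k
  have [measurable]: "f k \<in> borel_measurable \<Omega>" for k
    unfolding f_def by measurable
  have f_sums: "(\<lambda>k. f k \<omega>) sums 1" for \<omega>
  proof -
    have "(\<lambda>k. exp (- Z \<omega>) * (Z \<omega> ^ k /\<^sub>R fact k)) sums (exp (- Z \<omega>) * exp (Z \<omega>))"
      by (intro sums_mult exp_converges)
    then show ?thesis by (simp add: f_def divide_inverse_commute mult_ac flip: exp_add)
  qed
  have f_nonneg: "AE \<omega> in \<Omega>. \<forall>k. f k \<omega> \<ge> 0"
    using nonneg by eventually_elim (simp add: f_def)
  have f_le: "AE \<omega> in \<Omega>. \<forall>k. norm (f k \<omega>) \<le> 1"
    using f_nonneg
  proof eventually_elim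
    case (elim \<omega>)
    then have "f k \<omega> \<le> 1" for k
      using sum_le_suminf[of "\<lambda>k. f k \<omega>" "{k}"] f_sums[of \<omega>] by (auto simp: sums_iff)
    then show ?case using elim by simp
  qed
  have f_int: "integrable \<Omega> (f k)" for k
    by (rule integrable_const_bound[of _ 1]) (use f_le in auto)
  have p_nonneg: "p k \<ge> 0" for k
    unfolding p_def by (rule integral_nonneg_AE) (use f_nonneg in auto)
  have "ennreal (p k) = (\<integral>\<^sup>+\<omega>. ennreal (f k \<omega>) \<partial>\<Omega>)" for k
    unfolding p_def by (rule nn_integral_eq_integral[OF f_int, symmetric]) (use f_nonneg in auto)
  then have "(\<Sum>k. ennreal (p k)) = (\<Sum>k. \<integral>\<^sup>+\<omega>. ennreal (f k \<omega>) \<partial>\<Omega>)"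
    by simp
  also have "\<dots> = (\<integral>\<^sup>+\<omega>. (\<Sum>k. ennreal (f k \<omega>)) \<partial>\<Omega>)"
    by (rule nn_integral_suminf[symmetric]) simp
  also have "\<dots> = (\<integral>\<^sup>+\<omega>. ennreal 1 \<partial>\<Omega>)"
  proof (rule nn_integral_cong_AE)
    show "AE \<omega> in \<Omega>. (\<Sum>k. ennreal (f k \<omega>)) = ennreal 1"
      using f_nonneg
    proof eventually_elim
      case (elim \<omega>)
      show ?case by (rule suminf_ennreal_eq[OF _ f_sums]) (use elim in blast)
    qed
  qed
  also have "\<dots> = 1" by (simp add: emeasure_space_1)
  finally have p_sum: "(\<Sum>k. ennreal (p k)) = 1" .
  define W where "W = embed_pmf p"
  have W: "pmf W k = p k" for k
    unfolding W_def using p_nonneg p_sum by (intro pmf_embed_pmf) (auto simp: nn_integral_count_space_nat)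
  have p_summable: "summable p"
    using p_sum by (intro summable_suminf_not_top p_nonneg) simp
  have "char (distr (measure_pmf W) borel real) t = (CLINT \<omega>|\<Omega>. exp ((iexp t - 1) * of_real (Z \<omega>)))" for t
  proof -
    let ?w = "iexp t"
    have w: "norm (?w ^ k) = 1" for k by (simp add: norm_power)
    have "char (distr (measure_pmf W) borel real) t = measure_pmf.expectation W (\<lambda>k. ?w ^ k)"
      unfolding char_def by (subst integral_distr) (simp_all only: iexp_times_nat, simp_all)
    also have "\<dots> = (CLINT k|count_space UNIV. p k *\<^sub>R ?w ^ k)"
      by (simp add: measure_pmf_eq_density integral_density W p_nonneg)
    also have "\<dots> = (\<Sum>k. p k *\<^sub>R ?w ^ k)"
      using p_summable p_nonneg w by (intro integral_count_space_nat)
        (simp add: integrable_count_space_nat_iff)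
    also have "\<dots> = (\<Sum>k. CLINT \<omega>|\<Omega>. f k \<omega> *\<^sub>R ?w ^ k)"
      unfolding p_def using f_int by simp
    also have "\<dots> = (CLINT \<omega>|\<Omega>. (\<Sum>k. f k \<omega> *\<^sub>R ?w ^ k))"
    proof (rule integral_suminf[symmetric])
      show "integrable \<Omega> (\<lambda>\<omega>. f k \<omega> *\<^sub>R ?w ^ k)" for k using f_int by simp
      show "AE \<omega> in \<Omega>. summable (\<lambda>k. norm (f k \<omega> *\<^sub>R ?w ^ k))"
        using f_nonneg
      proof eventually_elim
        case (elim \<omega>)
        then show ?case using sums_summable[OF f_sums[of \<omega>]] w by simp
      qed
      have "(LINT \<omega>|\<Omega>. norm (f k \<omega> *\<^sub>R ?w ^ k)) = p k" for k
        unfolding p_def by (rule integral_cong_AE) (use f_nonneg w in auto)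
      then show "summable (\<lambda>k. LINT \<omega>|\<Omega>. norm (f k \<omega> *\<^sub>R ?w ^ k))" using p_summable by simp
    qed
    also have "(\<lambda>\<omega>. \<Sum>k. f k \<omega> *\<^sub>R ?w ^ k) = (\<lambda>\<omega>. exp ((?w - 1) * of_real (Z \<omega>)))"
    proof
      fix \<omega>
      have "(\<lambda>k. exp (- of_real (Z \<omega>)) * ((of_real (Z \<omega>) * ?w) ^ k /\<^sub>R fact k)) sums
          (exp (- of_real (Z \<omega>)) * exp (of_real (Z \<omega>) * ?w))"
        by (intro sums_mult exp_converges)
      moreover have "exp (- of_real (Z \<omega>)) * ((of_real (Z \<omega>) * ?w) ^ k /\<^sub>R fact k) = f k \<omega> *\<^sub>R ?w ^ k" for k
        by (simp add: f_def scaleR_conv_of_real power_mult_distrib divide_inverse exp_of_real[symmetric] mult_ac)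
      moreover have "exp (- of_real (Z \<omega>)) * exp (of_real (Z \<omega>) * ?w) = exp ((?w - 1) * of_real (Z \<omega>))"
        by (simp add: algebra_simps flip: exp_add)
      ultimately show "(\<Sum>k. f k \<omega> *\<^sub>R ?w ^ k) = exp ((?w - 1) * of_real (Z \<omega>))"
        by (simp add: sums_iff)
    qed
    finally show ?thesis .
  qed
  moreover have "pmf W k = 1 / fact k * (LINT \<omega>|\<Omega>. exp (- Z \<omega>) * Z \<omega> ^ k)" for k
    unfolding W p_def f_def by simp
  ultimately show ?thesis by blast
qed

section \<open>Limits of the normalised number of edges\<close>

text \<open>
  Integrate the bounded continuous function \<open>min 1 (max 0 (- x))\<close>, which vanishes exactly on the
  nonnegative reals.
\<close>
lemma weak_limit_nonneg:
  assumes \<mu>: "\<And>n. real_distribution (\<mu> n)" and \<nu>: "real_distribution \<nu>" and conv: "weak_conv_m \<mu> \<nu>"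
    and nonneg: "\<And>n. AE x in \<mu> n. x \<ge> 0"
  shows "AE x in \<nu>. x \<ge> 0"
proof -
  interpret real_distribution \<nu> by fact
  let ?g = "\<lambda>x. min 1 (max 0 (- x)) :: real"
  have "(\<lambda>n. LINT x|\<mu> n. ?g x) \<longlonglongrightarrow> (LINT x|\<nu>. ?g x)"
  proof (rule weak_conv_imp_integral_bdd_continuous_conv[OF \<mu> \<nu> conv])
    show "isCont ?g x" for x by (intro continuous_intros)
    show "norm (?g x) \<le> 1" for x by (auto simp: min_def max_def)
  qed
  moreover have "(LINT x|\<mu> n. ?g x) = 0" for n
  proof (rule integral_eq_zero_AE)
    show "AE x in \<mu> n. ?g x = 0" using nonneg[of n] by eventually_elim auto
  qed
  ultimately have "(LINT x|\<nu>. ?g x) = 0" by (simp add: LIMSEQ_const_iff)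
  moreover have "integrable \<nu> ?g"
    by (rule integrable_const_bound[of _ 1]) auto
  ultimately have "AE x in \<nu>. ?g x = 0"
    by (subst (asm) integral_nonneg_eq_0_iff_AE) auto
  then show ?thesis by eventually_elim (auto simp: min_def max_def split: if_splits)
qed

text \<open>
  The point mass at 0 has a distribution function that is continuous except at 0, so the events
  \<open>X \<le> x\<close> matter only for \<open>x < 0\<close>, where they are empty, and for \<open>x > 0\<close>.
\<close>
lemma weak_conv_return_0:
  assumes nonneg: "\<And>n E. 0 \<le> X n E"
    and conv: "tendsto_in_prob (\<lambda>n. measure_pmf (G n)) X 0"
  shows "weak_conv_m (\<lambda>n. distr (measure_pmf (G n)) borel (X n)) (return borel 0)"
  unfolding weak_conv_m_def weak_conv_def
proof (intro allI impI)
  interpret real_distribution "return borel (0::real)"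
    by (auto intro!: prob_space_return simp: real_distribution_def real_distribution_axioms_def)
  fix x :: real assume "isCont (cdf (return borel 0)) x"
  then have "x \<noteq> 0" by (auto simp: isCont_cdf measure_return)
  have cdf: "cdf (distr (measure_pmf (G n)) borel (X n)) x = measure_pmf.prob (G n) {E. X n E \<le> x}" for n
    by (simp add: cdf_def measure_distr vimage_def)
  show "(\<lambda>n. cdf (distr (measure_pmf (G n)) borel (X n)) x) \<longlonglongrightarrow> cdf (return borel 0) x"
  proof (cases "x < 0")
    case True
    then have "{E. X n E \<le> x} = {}" for n using nonneg[of n] by (auto simp: not_le intro: less_le_trans)
    then show ?thesis using True unfolding cdf by (simp add: cdf_def measure_return)
  next
    case False
    then have "x > 0" using \<open>x \<noteq> 0\<close> by simp
    then have "(\<lambda>n. 1 - measure_pmf.prob (G n) {E. x < \<bar>X n E - 0\<bar>}) \<longlonglongrightarrow> 1 - 0"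
      using conv unfolding tendsto_in_prob_def by (intro tendsto_diff) auto
    moreover have "1 - measure_pmf.prob (G n) {E. x < \<bar>X n E - 0\<bar>} = measure_pmf.prob (G n) {E. X n E \<le> x}" for n
      using nonneg measure_pmf.prob_compl[of "{E. x < \<bar>X n E - 0\<bar>}" "G n"]
      by (simp add: Compl_eq_Diff_UNIV[symmetric] Collect_neg_eq[symmetric] not_less)
    ultimately show ?thesis using \<open>x > 0\<close> unfolding cdf by (simp add: cdf_def measure_return)
  qed
qed

text \<open>
  Condition on the graph: if it has more than \<open>L * c\<close> edges, then the concentration bound makes it
  improbable that at most \<open>K\<close> of them are monochromatic.
\<close>
lemma prob_many_mono_edges_ge:
  assumes G: "set_pmf p \<subseteq> simple_graphs n" and c: "c > 0" and L: "L > 0" "2 * K \<le> L"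
  shows "measure_pmf.prob (coloured_graph n c p) {(E, y). real (mono_edges E y) > K} \<ge>
    (1 - 4 / L) * measure_pmf.prob p {E. real (card E) / real c > L}"
proof -
  let ?Q = "\<lambda>E. measure_pmf.prob (random_colouring {1..n} c) {y. real (mono_edges E y) > K}"
  note [simp] = integrable_measure_pmf_finite[OF finite_set_pmf_simple_graphs[OF G]]
  have "(1 - 4 / L) * measure_pmf.prob p {E. real (card E) / real c > L} =
      measure_pmf.expectation p (\<lambda>E. (1 - 4 / L) * indicator {E. real (card E) / real c > L} E)"
    by simp
  also have "\<dots> \<le> measure_pmf.expectation p ?Q"
  proof (intro integral_mono_AE AE_pmfI)
    fix E assume "E \<in> set_pmf p"
    then have E: "E \<subseteq> edges_on {1..n}" using G by (auto simp: simple_graphs_eq)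
    show "(1 - 4 / L) * indicator {E. real (card E) / real c > L} E \<le> ?Q E"
    proof (cases "real (card E) / real c > L")
      case True
      then have pos: "card E > 0" using L by (intro Nat.gr0I) auto
      have "1 - 4 / L \<le> 1 - 4 / (real (card E) / real c)"
        using True L c pos by (intro diff_left_mono divide_left_mono) auto
      also have "\<dots> \<le> 1 - measure_pmf.prob (random_colouring {1..n} c) {y. real (mono_edges E y) \<le> K}"
        using prob_few_mono_edges_le[OF _ E c _ pos, of K] L True by simp
      also have "\<dots> = ?Q E"
        using measure_pmf.prob_compl[of "{y. real (mono_edges E y) \<le> K}" "random_colouring {1..n} c"]
        by (simp add: Compl_eq_Diff_UNIV[symmetric] Collect_neg_eq[symmetric] not_le)
      finally show ?thesis using True by simp
    qed simp
  qed auto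
  also have "\<dots> = measure_pmf.expectation p (\<lambda>E. measure_pmf.expectation (random_colouring {1..n} c)
      (\<lambda>y. indicator {(E, y). real (mono_edges E y) > K} (E, y)))"
  proof (intro Bochner_Integration.integral_cong refl)
    fix E
    have "(\<lambda>y. indicator {(E, y). real (mono_edges E y) > K} (E, y)) =
        (indicator {y. real (mono_edges E y) > K} :: _ \<Rightarrow> real)"
      by (auto simp: indicator_def)
    then show "?Q E = measure_pmf.expectation (random_colouring {1..n} c)
        (\<lambda>y. indicator {(E, y). real (mono_edges E y) > K} (E, y))"
      by simp
  qed
  also have "\<dots> = measure_pmf.prob (coloured_graph n c p) {(E, y). real (mono_edges E y) > K}"
    by (subst expectation_coloured_graph[OF G c, symmetric]) simp
  finally show ?thesis .
qed

section \<open>The limit theorem\<close>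

theorem theorem1p1:
  fixes G :: "nat \<Rightarrow> (nat \<times> nat) set pmf"
    and c :: "nat \<Rightarrow> nat"
  assumes G: "\<And>n. n \<ge> 1 \<Longrightarrow> set_pmf (G n) \<subseteq> simple_graphs n"
    and c_pos: "\<And>n. n \<ge> 1 \<Longrightarrow> c n > 0"
    and c_lim: "filterlim c at_top sequentially"
  defines "D \<equiv> \<lambda>n E. real (card E) / real (c n)"
    and "P \<equiv> \<lambda>n. measure_pmf (coloured_graph n (c n) (G n))"
    and "N \<equiv> \<lambda>(n::nat) (E, y). real (mono_edges E y)"
  shows "(tendsto_in_prob (\<lambda>n. measure_pmf (G n)) D 0 \<longrightarrow>
            tendsto_in_distr P N (return borel 0)) \<and>
         (tendsto_infinity_in_prob (\<lambda>n. measure_pmf (G n)) D \<longrightarrow>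
            tendsto_infinity_in_prob P N) \<and>
         (\<forall>(\<Omega> :: 'a measure) Z.
            prob_space \<Omega> \<longrightarrow> Z \<in> borel_measurable \<Omega> \<longrightarrow>
            tendsto_in_distr (\<lambda>n. measure_pmf (G n)) D (distr \<Omega> borel Z) \<longrightarrow>
            (\<exists>W :: nat pmf.
               (\<forall>k. pmf W k = 1 / fact k * (LINT \<omega>|\<Omega>. exp (- Z \<omega>) * Z \<omega> ^ k)) \<and>
               tendsto_in_distr P N (distr (measure_pmf W) borel real)))"
proof (intro conjI impI allI)
  have real_distr: "real_distribution (distr (P n) borel (N n))" for n
    unfolding P_def by (rule real_distribution_distr_pmf)
  \<comment> \<open>By Levy's continuity theorem, a limit in distribution of the normalised number of edges determines
    that of the number of monochromatic edges. The first claim is the case of a point mass at 0.\<close>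
  have conv: "tendsto_in_distr P N \<mu>"
    if \<nu>: "real_distribution \<nu>" "weak_conv_m (\<lambda>n. distr (G n) borel (D n)) \<nu>"
      and \<mu>: "real_distribution \<mu>" "\<And>t. char \<mu> t = (CLINT x|\<nu>. exp ((iexp t - 1) * of_real \<bar>x\<bar>))"
    for \<mu> \<nu> :: "real measure"
    unfolding tendsto_in_distr_def
  proof (rule levy_continuity[OF real_distr \<mu>(1)])
    show "(\<lambda>n. char (distr (P n) borel (N n)) t) \<longlonglongrightarrow> char \<mu> t" for t
      unfolding \<mu>(2) P_def N_def
      by (rule char_mono_edges_tendsto_mixed_poisson[OF G c_pos c_lim \<nu>(1)]) (use \<nu>(2) in \<open>simp_all add: D_def\<close>)
  qed
  {
    assume "tendsto_in_prob (\<lambda>n. measure_pmf (G n)) D 0"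
    then have "weak_conv_m (\<lambda>n. distr (G n) borel (D n)) (return borel 0)"
      by (rule weak_conv_return_0[rotated]) (simp add: D_def)
    moreover have "real_distribution (return borel (0 :: real))"
      by (auto intro!: prob_space_return simp: real_distribution_def real_distribution_axioms_def)
    moreover have "char (return borel 0) t = (CLINT x|return borel 0. exp ((iexp t - 1) * of_real \<bar>x\<bar>))" for t
      unfolding char_def by (subst (1 2) integral_return) simp_all
    ultimately show "tendsto_in_distr P N (return borel 0)"
      by (intro conv[of "return borel 0" "return borel 0"])
  next
    assume D: "tendsto_infinity_in_prob (\<lambda>n. measure_pmf (G n)) D"
    show "tendsto_infinity_in_prob P N"
      unfolding tendsto_infinity_in_prob_def
    proof
      fix K :: real
      let ?p = "\<lambda>n. measure (P n) {\<omega> \<in> space (P n). N n \<omega> > K}"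
      show "?p \<longlonglongrightarrow> 1"
      proof (rule LIMSEQ_I)
        fix \<epsilon> :: real assume \<epsilon>: "\<epsilon> > 0"
        \<comment> \<open>The conditional failure probability \<open>4 / L\<close> is to be at most \<open>\<epsilon> / 2\<close>.\<close>
        define L where "L = max (8 / \<epsilon>) (2 * K)"
        have "8 / \<epsilon> > 0" using \<epsilon> by simp
        then have L: "L > 0" "2 * K \<le> L" unfolding L_def by linarith+
        have "4 / L \<le> 4 / (8 / \<epsilon>)"
          using \<epsilon> L(1) by (intro divide_left_mono) (auto simp: L_def)
        then have L_small: "4 / L \<le> \<epsilon> / 2" by simp
        have "(\<lambda>n. measure (G n) {E. D n E > L}) \<longlonglongrightarrow> 1"
          using D by (simp add: tendsto_infinity_in_prob_def)
        then have "\<forall>\<^sub>F n in sequentially. measure (G n) {E. D n E > L} > 1 - \<epsilon> / 2"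
          using \<epsilon> by (intro order_tendstoD(1)) auto
        then have "\<forall>\<^sub>F n in sequentially. norm (?p n - 1) < \<epsilon>"
          using eventually_ge_at_top[of 1]
        proof eventually_elim
          case (elim n)
          define q where "q = measure (G n) {E. D n E > L}"
          have "(1 - 4 / L) * q \<le> ?p n"
            using prob_many_mono_edges_ge[OF G[OF elim(2)] c_pos[OF elim(2)] L(1,2)]
            by (simp add: P_def N_def D_def q_def case_prod_unfold)
          moreover have "(1 - 4 / L) * q = q - 4 / L * q" by (simp add: algebra_simps)
          moreover have "4 / L * q \<le> \<epsilon> / 2 * 1"
            using L_small \<epsilon> by (intro mult_mono) (auto simp: q_def)
          moreover have "?p n \<le> 1" unfolding P_def by simp
          ultimately show ?case using elim(1) unfolding q_def[symmetric] by simp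
        qed
        then show "\<exists>no. \<forall>n\<ge>no. norm (?p n - 1) < \<epsilon>"
          by (simp add: eventually_sequentially)
      qed
    qed
  next
    fix \<Omega> :: "'a measure" and Z
    assume \<Omega>: "prob_space \<Omega>" and Z [measurable]: "Z \<in> borel_measurable \<Omega>"
      and "tendsto_in_distr (\<lambda>n. measure_pmf (G n)) D (distr \<Omega> borel Z)"
    then have D: "weak_conv_m (\<lambda>n. distr (G n) borel (D n)) (distr \<Omega> borel Z)"
      by (simp add: tendsto_in_distr_def)
    have law: "real_distribution (distr \<Omega> borel Z)"
      using \<Omega> Z by (rule prob_space.real_distribution_distr)
    have "AE x in distr \<Omega> borel Z. x \<ge> 0"
      by (rule weak_limit_nonneg[OF real_distribution_distr_pmf law D])
        (simp add: AE_distr_iff D_def)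
    then have nonneg: "AE \<omega> in \<Omega>. Z \<omega> \<ge> 0" by (simp add: AE_distr_iff)
    then obtain W :: "nat pmf" where W: "\<And>k. pmf W k = 1 / fact k * (LINT \<omega>|\<Omega>. exp (- Z \<omega>) * Z \<omega> ^ k)"
      "\<And>t. char (distr (measure_pmf W) borel real) t = (CLINT \<omega>|\<Omega>. exp ((iexp t - 1) * of_real (Z \<omega>)))"
      using ex_mixed_poisson_pmf[OF \<Omega> Z] by blast
    have "char (distr (measure_pmf W) borel real) t =
        (CLINT x|distr \<Omega> borel Z. exp ((iexp t - 1) * of_real \<bar>x\<bar>))" for t
      unfolding W(2) by (subst integral_distr) (use nonneg in \<open>auto intro!: integral_cong_AE\<close>)
    then have "tendsto_in_distr P N (distr (measure_pmf W) borel real)"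
      by (intro conv[OF law D real_distribution_distr_pmf])
    then show "\<exists>W :: nat pmf. (\<forall>k. pmf W k = 1 / fact k * (LINT \<omega>|\<Omega>. exp (- Z \<omega>) * Z \<omega> ^ k)) \<and>
        tendsto_in_distr P N (distr (measure_pmf W) borel real)"
      using W(1) by blast
  }
qed

end
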